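(* Let $p\geq1$ and let $b_i\geq a_i>0$ be such that $$b_i>\frac{-2+\sqrt5\,a_i+\sqrt{(\sqrt5\,a_i-2)^2+8a_i\sqrt5\,\bigl(e(a_i+1)-a_i\bigr)}}{4}\qquad\text{for all }1\leq i\leq p.$$ Then the normalized hypergeometric function $${}_p\tilde{F}_{p}\left[{a_1,\dots,a_p\atop b_1,\dots,b_p}\Big|z\right]=z\;{}_pF_{p}\left[{a_1,\dots,a_p\atop b_1,\dots,b_p}\Big|z\right]$$ is starlike in $\mathcal{D}=\{z\in\mathbb{C}:|z|<1\}$.
   Context: ${}_pF_q\left[{a_1,\dots,a_p\atop b_1,\dots,b_q}\big|z\right]=\sum_{k=0}^\infty\frac{(a_1)_k\cdots(a_p)_k}{(b_1)_k\cdots(b_q)_k}\frac{z^k}{k!}$ is the generalized hypergeometric function, with $(a)_k=\Gamma(a+k)/\Gamma(a)$. A function $f(z)=z+\sum_{k\ge2}c_kz^k$ analytic in $\mathcal{D}$ is starlike in $\mathcal{D}$ if it is univalent and $f(\mathcal{D})$ is starlike with respect to the origin; equivalently $\Re\left(zf'(z)/f(z)\right)>0$ for all $z\in\mathcal{D}$. Here $e=\exp(1)$. *)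

theory Defs
  imports "HOL-Analysis.Analysis"
begin

text \<open>
  The numerator and denominator parameters are lists. The factor \<open>1/k!\<close> is part of
  \<^const>\<open>fps_hypergeo\<close>; its last argument rescales the variable and is therefore \<open>1\<close> here.
\<close>

definition hypergeometric :: "complex list \<Rightarrow> complex list \<Rightarrow> complex \<Rightarrow> complex" where
  "hypergeometric as bs z = eval_fps (fps_hypergeo as bs 1) z"

lemma foldl_mult_eq_prod:
  fixes c :: "'a :: comm_monoid_mult"
  shows "foldl (\<lambda>r x. r * f x) c xs = c * (\<Prod>i<length xs. f (xs ! i))"
proof (induction xs rule: rev_induct)
  case Nil
  then show ?case by simp
next
  case (snoc x xs)
  have "(\<Prod>i<length xs. f ((xs @ [x]) ! i)) = (\<Prod>i<length xs. f (xs ! i))"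
    by (intro prod.cong) (auto simp: nth_append)
  with snoc show ?case by (simp add: mult.assoc)
qed

lemma hypergeometric_eq_suminf:
  "hypergeometric as bs z =
     (\<Sum>k. (\<Prod>i<length as. pochhammer (as ! i) k) / (\<Prod>i<length bs. pochhammer (bs ! i) k)
            * (z ^ k / fact k))"
  unfolding hypergeometric_def eval_fps_def fps_hypergeo_nth foldl_mult_eq_prod
  by (simp add: field_simps)

definition normalized_hypergeometric ::
    "complex list \<Rightarrow> complex list \<Rightarrow> complex \<Rightarrow> complex" where
  "normalized_hypergeometric as bs z = z * hypergeometric as bs z"

text \<open>
  Starlikeness with the origin as centre; the library's \<^const>\<open>starlike\<close> allows any centre.
\<close>

definition starlike_wrt_origin :: "complex set \<Rightarrow> bool" where
  "starlike_wrt_origin S \<longleftrightarrow> 0 \<in> S \<and> (\<forall>w\<in>S. closed_segment 0 w \<subseteq> S)"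

text \<open>
  The conditions \<open>f 0 = 0\<close> and \<open>deriv f 0 = 1\<close> express that \<open>f(z) = z + c\<^sub>2 z\<^sup>2 + c\<^sub>3 z\<^sup>3 + \<dots>\<close>.
\<close>

definition starlike_function :: "(complex \<Rightarrow> complex) \<Rightarrow> bool" where
  "starlike_function f \<longleftrightarrow>
     f holomorphic_on ball 0 1 \<and> f 0 = 0 \<and> deriv f 0 = 1 \<and>
     inj_on f (ball 0 1) \<and> starlike_wrt_origin (f ` ball 0 1)"

end

theory Submission
  imports Defs "HOL-Complex_Analysis.Complex_Analysis" "HOL-Probability.Probability"
begin

text \<open>
  The bound forces \<open>a\<^sub>i < b\<^sub>i\<close>, so \<open>(a\<^sub>i)\<^sub>k / (b\<^sub>i)\<^sub>k\<close> is the \<open>k\<close>-th moment of a Beta distribution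
  and the hypergeometric function is \<open>F z = E (exp (z T))\<close> with \<open>T \<in> [0, 1]\<close> a product of independent Beta variables. With \<open>f z = z * F z\<close> and an independent copy \<open>S\<close> of \<open>T\<close>,
  \<open>Re (f'(z) * cnj (F z))\<close> is half the expectation of
  \<open>Re ((1 + z T) exp (z T) cnj (exp (z S)) + (1 + z S) exp (z S) cnj (exp (z T)))\<close>, and this
  expression is positive pointwise for \<open>\<bar>z\<bar> < 1\<close>. Hence \<open>Re (z * f'(z) / f z) > 0\<close>.

  This condition says that \<open>\<bar>z\<bar>\<close> decreases when \<open>f z\<close> is moved radially towards \<open>0\<close>. So a segment
  from \<open>f z\<close> to \<open>0\<close> lifts to the disc, and two distinct preimages of one point could be moved down
  together until both reach \<open>0\<close>, the only zero of \<open>f\<close>.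
\<close>

section \<open>Starlikeness from the condition \<open>Re (z * deriv f z / f z) > 0\<close>\<close>

text \<open>A local inverse \<open>g\<close> lifts the radial path \<open>(1 - h) * f z\<close> to a
  path starting at \<open>z\<close> with velocity \<open>- f z / deriv f z\<close>. The squared norm
  along the lift has derivative \<open>- 2 * Re (cnj z * f z / deriv f z)\<close> at
  \<open>h = 0\<close>, which is negative because \<open>w\<close> and \<open>1 / w\<close> have
  real parts of the same sign.\<close>

lemma starlike_descent:
  fixes f :: "complex \<Rightarrow> complex"
  assumes hol: "f holomorphic_on A" and "open A" "z \<in> A"
    and pos: "0 < Re (z * deriv f z / f z)" and "0 < e"
  shows "\<exists>d>0. \<forall>h. 0 < h \<and> h < d \<longrightarrow>
           (\<exists>z'. dist z z' < e \<and> norm z' \<le> norm z \<and> z' \<in> A \<and> f z' = of_real (1 - h) * f z)"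
proof -
  \<comment> \<open>If any of the three were zero, the quotient in \<open>pos\<close> would be
    \<open>0\<close>; this includes \<open>f z = 0\<close>, since division by zero yields
    \<open>0\<close>.\<close>
  have "z \<noteq> 0" "f z \<noteq> 0" and df: "deriv f z \<noteq> 0"
    using pos by auto
  have "f holomorphic_on (A \<inter> ball z e)" "open (A \<inter> ball z e)" "z \<in> A \<inter> ball z e"
    using assms by (auto intro: holomorphic_on_subset)
  then obtain r where r: "r > 0" "ball z r \<subseteq> A \<inter> ball z e" "open (f ` ball z r)" "inj_on f (ball z r)"
    using has_complex_derivative_locally_invertible[OF _ _ _ df] by metis
  have holr: "f holomorphic_on ball z r"
    using hol r by (auto intro: holomorphic_on_subset)
  obtain g where g: "g holomorphic_on (f ` ball z r)"
      "\<And>u. u \<in> ball z r \<Longrightarrow> deriv f u * deriv g (f u) = 1" "\<And>u. u \<in> ball z r \<Longrightarrow> g (f u) = u"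
    using holomorphic_has_inverse[OF holr _ r(4)] by auto
  define p where "p = (\<lambda>h::real. g (of_real (1 - h) * f z))"
  define \<phi> where "\<phi> = (\<lambda>h::real. (Re (p h))\<^sup>2 + (Im (p h))\<^sup>2)"
  have p0: "p 0 = z" using g(3)[of z] r(1) by (simp add: p_def)
  have "(g has_field_derivative deriv g (f z)) (at (f z))"
    using g(1) r(1,3) by (intro holomorphic_derivI) auto
  moreover have "((\<lambda>h::real. of_real (1 - h) * f z) has_vector_derivative - f z) (at 0)"
    by (auto intro!: derivative_eq_intros simp: has_vector_derivative_def scaleR_conv_of_real)
  ultimately have "(p has_vector_derivative (- f z * deriv g (f z))) (at 0)"
    unfolding p_def using field_vector_diff_chain_at[of "\<lambda>h::real. of_real (1 - h) * f z" "- f z" 0 g "deriv g (f z)"]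
    by (simp add: o_def)
  moreover have gd: "deriv g (f z) = 1 / deriv f z"
    using g(2)[of z] r(1) df by (simp add: field_simps)
  ultimately have dp: "(p has_vector_derivative (- (f z / deriv f z))) (at 0)" by simp
  have re: "((\<lambda>h. Re (p h)) has_real_derivative Re (- (f z / deriv f z))) (at 0)"
    and im: "((\<lambda>h. Im (p h)) has_real_derivative Im (- (f z / deriv f z))) (at 0)"
    using dp has_vector_derivative_complex_iff[of p] has_real_derivative_iff_has_vector_derivative by blast+
  let ?q = "f z / deriv f z"
  have "(\<phi> has_real_derivative - 2 * Re (cnj z * ?q)) (at 0)"
    unfolding \<phi>_def
    using DERIV_add[OF DERIV_power[OF re, of 2] DERIV_power[OF im, of 2]] by (simp add: p0 algebra_simps del: times_divide_eq_right times_divide_eq_left)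
  moreover have "0 < Re (cnj z * ?q)"
  proof -
    let ?w = "z * deriv f z / f z"
    have "?w \<noteq> 0" using pos by auto
    have nz: "of_real ((norm z)\<^sup>2) = z * cnj z"
      by (rule complex_norm_square)
    have "cnj z * ?q = of_real ((norm z)\<^sup>2) * (1 / ?w)"
      unfolding nz using \<open>z \<noteq> 0\<close> by simp
    then have "Re (cnj z * ?q) = Re (of_real ((norm z)\<^sup>2) * (1 / ?w))" by (rule arg_cong)
    also have "\<dots> = (norm z)\<^sup>2 * Re (1 / ?w)"
      by (simp only: times_complex.sel Re_complex_of_real Im_complex_of_real mult_zero_left diff_zero)
    also have "\<dots> = (norm z)\<^sup>2 * (Re ?w / (norm ?w)\<^sup>2)"
      by (simp only: Re_divide cmod_power2) simp
    also have "\<dots> > 0" using \<open>z \<noteq> 0\<close> \<open>?w \<noteq> 0\<close> pos by (simp del: times_divide_eq_left times_divide_eq_right)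
    finally show ?thesis .
  qed
  ultimately obtain d1 where d1: "d1 > 0" "\<And>h. 0 < h \<Longrightarrow> h < d1 \<Longrightarrow> \<phi> h < \<phi> 0"
    using DERIV_neg_dec_right[of \<phi> "- 2 * Re (cnj z * ?q)" 0] by auto
  obtain \<epsilon> where \<epsilon>: "\<epsilon> > 0" "ball (f z) \<epsilon> \<subseteq> f ` ball z r"
    using r(1,3) by (metis centre_in_ball image_eqI openE)
  \<comment> \<open>The first bound makes the norm decrease; the second keeps
    \<open>of_real (1 - h) * f z\<close> within \<epsilon> of \<open>f z\<close>, so that it has a
    preimage in \<open>ball z r\<close>.\<close>
  define d where "d = min d1 (\<epsilon> / norm (f z))"
  have "d > 0" using d1 \<epsilon> \<open>f z \<noteq> 0\<close> by (simp add: d_def)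
  moreover have "\<exists>z'. dist z z' < e \<and> norm z' \<le> norm z \<and> z' \<in> A \<and> f z' = of_real (1 - h) * f z"
    if "0 < h" "h < d" for h
  proof -
    have "f z - of_real (1 - h) * f z = of_real h * f z" by (simp add: algebra_simps)
    then have "dist (f z) (of_real (1 - h) * f z) = h * norm (f z)"
      using that by (simp add: dist_norm norm_mult del: of_real_diff)
    also have "\<dots> < \<epsilon>" using that \<open>f z \<noteq> 0\<close> by (simp add: d_def pos_less_divide_eq)
    finally obtain u where u: "u \<in> ball z r" "f u = of_real (1 - h) * f z"
      using \<epsilon>(2) by (metis imageE mem_ball subsetD)
    then have "p h = u" using g(3)[of u] by (simp add: p_def)
    then have "norm u \<le> norm z" using d1(2)[of h] that p0 
      by (simp add: \<phi>_def d_def norm_complex_def)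
    then show ?thesis using u r(2) by (intro exI[of _ u]) auto
  qed
  ultimately show ?thesis by blast
qed

lemma compact_attains_min_fst:
  fixes C :: "(real \<times> 'a::topological_space) set"
  assumes "compact C" "c \<in> C"
  obtains t u where "(t, u) \<in> C" "\<And>t' u'. (t', u') \<in> C \<Longrightarrow> t \<le> t'"
proof -
  have "\<exists>m\<in>C. \<forall>p\<in>C. fst m \<le> fst p"
    using assms by (intro continuous_attains_inf continuous_intros) auto
  then show ?thesis using that by (metis fst_conv surj_pair)
qed

text \<open>Injectivity and starlikeness follow the same scheme: the pairs of a scale
  \<open>t\<close> and a lift (or two distinct lifts) of \<open>t * w\<close> form a compact set,
  and at the least \<open>t\<close> a further descent step contradicts minimality. Minimality takes
  the place of continuing the lift along the whole segment.\<close>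

lemma starlike_functionI:
  assumes hol: "f holomorphic_on ball 0 1" and f0: "f 0 = 0" and f'0: "deriv f 0 = 1"
    and pos: "\<And>z. norm z < 1 \<Longrightarrow> z \<noteq> 0 \<Longrightarrow> 0 < Re (z * deriv f z / f z)"
  shows "starlike_function f"
proof -
  have nz: "f z \<noteq> 0" if "norm z < 1" "z \<noteq> 0" for z
    using pos[OF that] by auto
  have df: "deriv f z \<noteq> 0" if "norm z < 1" for z
    using pos[OF that] f'0 by (cases "z = 0") auto
  have cont: "continuous_on (ball 0 1) f"
    using hol by (rule holomorphic_on_imp_continuous_on)
  have descent: "\<exists>d>0. \<forall>h. 0 < h \<and> h < d \<longrightarrow>
           (\<exists>z'. dist z z' < e \<and> norm z' \<le> norm z \<and> f z' = of_real (1 - h) * f z)"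
    if "norm z < 1" "z \<noteq> 0" "0 < e" for z and e :: real
    using starlike_descent[OF hol open_ball _ pos[OF that(1,2)] that(3)] that(1) by force
  have "inj_on f (ball 0 1)"
  proof (rule inj_onI, rule ccontr)
    fix z1 z2 assume z: "z1 \<in> ball 0 1" "z2 \<in> ball 0 1" "f z1 = f z2" "z1 \<noteq> z2"
    define w r where "w = f z1" and "r = max (norm z1) (norm z2)"
    have r: "r < 1" using z by (simp add: r_def)
    have w: "w \<noteq> 0" using z nz[of z1] nz[of z2] f0 by (auto simp: w_def)
    have "\<exists>\<rho>>0. inj_on f (ball \<xi> \<rho>)" if "norm \<xi> < 1" for \<xi>
      using has_complex_derivative_locally_injective[OF hol _ open_ball df[OF that]] that by auto
    then obtain \<rho> where \<rho>: "\<And>\<xi>. norm \<xi> < 1 \<Longrightarrow> \<rho> \<xi> > 0 \<and> inj_on f (ball \<xi> (\<rho> \<xi>))"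
      by metis
    \<comment> \<open>Removing a neighbourhood of the diagonal on which \<open>f\<close> is injective keeps the set of pairs
      with equal image compact.\<close>
    define U where "U = (\<Union>\<xi>\<in>ball 0 1. ball \<xi> (\<rho> \<xi>) \<times> ball \<xi> (\<rho> \<xi>))"
    have "open U" by (auto simp: U_def intro!: open_UN open_Times)
    have diag: "(u, u) \<in> U" if "norm u < 1" for u
      using \<rho>[OF that] that by (auto simp: U_def intro!: bexI[of _ u])
    have U_inj: "u = v" if "(u, v) \<in> U" "f u = f v" for u v
      using that \<rho> by (fastforce simp: U_def dest: inj_onD)
    \<comment> \<open>Descent does not increase the norm, so all lifts remain in the closed disc of
      radius \<open>r < 1\<close>, where \<open>f\<close> is continuous.\<close>
    define K :: "(real \<times> complex \<times> complex) set" where "K = {0..1} \<times> cball 0 r \<times> cball 0 r"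
    have K: "compact K" by (simp add: K_def compact_Times)
    define g where "g = (\<lambda>(t, u, v). (f u - of_real t * w, f v - of_real t * w))"
    define C where "C = K \<inter> ({p \<in> K. g p = (0, 0)} \<inter> UNIV \<times> - U)"
    have "continuous_on K g"
      unfolding g_def K_def case_prod_unfold
      by (intro continuous_intros continuous_on_compose2[OF cont]) (use r in auto)
    then have "closed {p \<in> K. g p = (0, 0)}"
      using K by (intro continuous_closed_preimage_constant compact_imp_closed)
    moreover have "closed (UNIV \<times> (- U) :: (real \<times> complex \<times> complex) set)"
      using \<open>open U\<close> by (intro closed_Times) auto
    ultimately have "compact C"
      unfolding C_def by (intro compact_Int_closed K closed_Int)
    moreover have "(1, z1, z2) \<in> C"
      using z U_inj[of z1 z2] by (auto simp: C_def K_def g_def w_def r_def)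
    ultimately obtain t uv where m: "(t, uv) \<in> C" and min: "\<And>t' u'. (t', u') \<in> C \<Longrightarrow> t \<le> t'"
      using compact_attains_min_fst[of C] by metis
    obtain u v where uv: "uv = (u, v)" by (cases uv)
    have tuv: "0 \<le> t" "t \<le> 1" "norm u \<le> r" "norm v \<le> r" "f u = of_real t * w" "f v = of_real t * w" "(u, v) \<notin> U"
      using m by (auto simp: C_def K_def g_def uv)
    have "u \<noteq> v" using diag[of u] tuv r by auto
    \<comment> \<open>If \<open>t\<close> or one of the two points were \<open>0\<close>, then
      \<open>f u = f v = 0\<close>, and both points would be \<open>0\<close>, the only zero of
      \<open>f\<close>.\<close>
    have uv0: "u \<noteq> 0" "v \<noteq> 0" and t: "t > 0"
      using \<open>u \<noteq> v\<close> tuv w f0 nz[of u] nz[of v] r by (auto simp: order_less_le)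
    \<comment> \<open>Moving each point by less than half their distance keeps the two lifts
      distinct.\<close>
    have e: "0 < dist u v / 2" using \<open>u \<noteq> v\<close> by simp
    obtain d1 where d1: "d1 > 0" "\<And>h. 0 < h \<Longrightarrow> h < d1 \<Longrightarrow>
        \<exists>z'. dist u z' < dist u v / 2 \<and> norm z' \<le> norm u \<and> f z' = of_real (1 - h) * f u"
      using descent[OF _ uv0(1) e] tuv r by force
    obtain d2 where d2: "d2 > 0" "\<And>h. 0 < h \<Longrightarrow> h < d2 \<Longrightarrow>
        \<exists>z'. dist v z' < dist u v / 2 \<and> norm z' \<le> norm v \<and> f z' = of_real (1 - h) * f v"
      using descent[OF _ uv0(2) e] tuv r by force
    define h where "h = min (min d1 d2) 1 / 2"
    have h: "0 < h" "h < d1" "h < d2" "h < 1" using d1 d2 by (auto simp: h_def)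
    obtain u' v' where u': "dist u u' < dist u v / 2" "norm u' \<le> norm u" "f u' = of_real (1 - h) * f u"
      and v': "dist v v' < dist u v / 2" "norm v' \<le> norm v" "f v' = of_real (1 - h) * f v"
      using d1(2) d2(2) h by meson
    have "u' \<noteq> v'"
      using u'(1) v'(1) dist_triangle_half_r[of u' u "dist u v" v] dist_commute by (metis less_irrefl)
    then have "(u', v') \<notin> U" using U_inj[of u' v'] u' v' tuv by auto
    moreover have "(1 - h) * t \<le> 1" using h tuv by (intro mult_le_one) auto
    ultimately have "((1 - h) * t, u', v') \<in> C"
      using u' v' tuv h by (auto simp: C_def K_def g_def)
    from min[OF this] show False using mult_pos_pos[OF h(1) t] h t by (simp add: algebra_simps)
  qed
  moreover have "of_real t0 * f z \<in> f ` ball 0 1" if z: "norm z < 1" and t0: "0 \<le> t0" "t0 \<le> 1" for z and t0 :: real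
  proof (cases "z = 0")
    case True
    then show ?thesis using f0 by force
  next
    case False
    define w where "w = f z"
    have w: "w \<noteq> 0" using nz z False by (simp add: w_def)
    define K :: "(real \<times> complex) set" where "K = {t0..1} \<times> cball 0 (norm z)"
    have K: "compact K" by (simp add: K_def compact_Times)
    define g where "g = (\<lambda>(t, u). f u - of_real t * w)"
    define C where "C = K \<inter> {p \<in> K. g p = 0}"
    have "continuous_on K g"
      unfolding g_def K_def case_prod_unfold
      by (intro continuous_intros continuous_on_compose2[OF cont]) (use z in auto)
    then have "closed {p \<in> K. g p = 0}"
      using K by (intro continuous_closed_preimage_constant compact_imp_closed)
    then have "compact C"
      unfolding C_def by (intro compact_Int_closed K)
    moreover have "(1, z) \<in> C"
      using t0 by (auto simp: C_def K_def g_def w_def)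
    ultimately obtain t u where m: "(t, u) \<in> C" and min: "\<And>t' u'. (t', u') \<in> C \<Longrightarrow> t \<le> t'"
      using compact_attains_min_fst[of C] by metis
    have tu: "t0 \<le> t" "t \<le> 1" "norm u \<le> norm z" "f u = of_real t * w"
      using m by (auto simp: C_def K_def g_def)
    have "t = t0"
    proof (rule ccontr)
      assume "t \<noteq> t0"
      then have t: "t0 < t" "0 < t" using tu t0 by auto
      then have "u \<noteq> 0" using tu f0 w by auto
      have "norm u < 1" using tu z by simp
      obtain d where d: "d > 0" "\<And>h. 0 < h \<Longrightarrow> h < d \<Longrightarrow>
          \<exists>z'. dist u z' < 1 \<and> norm z' \<le> norm u \<and> f z' = of_real (1 - h) * f u"
        using descent[of u 1] \<open>norm u < 1\<close> \<open>u \<noteq> 0\<close> by (metis zero_less_one)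
      \<comment> \<open>The second bound gives \<open>(1 - h) * t \<ge> t0\<close>, so the new pair
        still lies in \<open>K\<close>.\<close>
      define h where "h = min (d / 2) ((t - t0) / t)"
      have h: "0 < h" "h < d" "h \<le> (t - t0) / t" using d t by (auto simp: h_def)
      then have ht: "h * t \<le> t - t0" using t by (simp add: field_simps)
      obtain u' where u': "norm u' \<le> norm u" "f u' = of_real (1 - h) * f u"
        using d(2) h by meson
      have "((1 - h) * t, u') \<in> C"
      proof -
        have "t0 \<le> (1 - h) * t" using ht by (simp add: algebra_simps)
        moreover have "0 < h * t" using h t by simp
        then have "(1 - h) * t \<le> 1" using tu by (simp add: algebra_simps)
        ultimately show ?thesis using u' tu by (simp add: C_def K_def g_def)
      qed
      from min[OF this] show False using mult_pos_pos[OF h(1) t(2)] h t by (simp add: algebra_simps)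
    qed
    then show ?thesis using tu z by (auto simp: w_def intro!: image_eqI[of _ _ u])
  qed
  then have "starlike_wrt_origin (f ` ball 0 1)"
    using f0 by (force simp: starlike_wrt_origin_def closed_segment_def scaleR_conv_of_real)
  ultimately show ?thesis
    using hol f0 f'0 by (simp add: starlike_function_def)
qed

section \<open>Pointwise positivity of the symmetrised kernel\<close>

text \<open>With \<open>z = x + i y\<close> and \<open>v = y * (t - s)\<close>, the real part equals
  \<open>exp (x * (t + s)) * ((2 + x * (t + s)) * cos v - v * sin v)\<close>. The worst case is
  negative \<open>x\<close>, whence \<open>X = \<bar>x\<bar>\<close>; the constraint on
  \<open>y\<close> from the unit disc enters as \<open>v\<^sup>2 \<le> q\<close>.\<close>

lemma one_plus_id_exp_kernel_pos:
  fixes z :: complex and s t :: real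
  assumes z: "norm z < 1" and t: "0 \<le> t" "t \<le> 1" and s: "0 \<le> s" "s \<le> 1"
  shows "0 < Re ((1 + z * t) * exp (z * t) * cnj (exp (z * s)) + (1 + z * s) * exp (z * s) * cnj (exp (z * t)))"
proof -
  define x y where "x = Re z" and "y = Im z"
  have xy: "x\<^sup>2 + y\<^sup>2 < 1"
    using z by (simp add: x_def y_def norm_complex_def)
  define d v where "d = \<bar>t - s\<bar>" and "v = y * (t - s)"
  define X q where "X = \<bar>x\<bar>" and "q = (1 - X\<^sup>2) * d\<^sup>2"
  have d: "0 \<le> d" "d \<le> 1" "t + s \<le> 2 - d" "0 \<le> t + s" using t s by (auto simp: d_def)
  have X2: "X\<^sup>2 < 1" using xy zero_le_power2[of y] unfolding X_def power2_abs by linarith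
  have X: "0 \<le> X" "X < 1" using X2 by (auto simp: X_def power2_less_1_iff)
  have vq: "v\<^sup>2 \<le> q"
    unfolding v_def q_def d_def X_def power_mult_distrib power2_abs
    using xy by (intro mult_right_mono) auto
  have q1: "q \<le> 1" unfolding q_def
    using X2 d by (intro mult_le_one) (auto simp: power_le_one)
  have v1: "v\<^sup>2 \<le> 1" using vq q1 by simp
  \<comment> \<open>Since \<open>t + s \<le> 2 - d\<close> and \<open>v\<^sup>2 \<le> q\<close>, it suffices to bound \<open>v tan v\<close> by \<open>v\<^sup>2 + 7/10 v\<^sup>4\<close>;
    convexity in \<open>d\<close> then reduces the claim to \<open>d = 0\<close> and \<open>d = 1\<close>.\<close>
  have lin: "q + 7/10 * q\<^sup>2 < 2 - 2 * X + d * X"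
  proof -
    define p where "p = 1 - X\<^sup>2"
    have p: "0 \<le> p" using X2 by (simp add: p_def)
    have "q \<le> d * p" using d p unfolding q_def p_def[symmetric]
      using mult_right_mono[of "d\<^sup>2" d p] by (simp add: power2_eq_square mult_left_le mult.commute)
    moreover have "q\<^sup>2 \<le> d * p\<^sup>2"
    proof -
      have "q\<^sup>2 = d^4 * p\<^sup>2" by (simp add: q_def p_def power_mult_distrib flip: power_mult)
      also have "\<dots> \<le> d^1 * p\<^sup>2" using d by (intro mult_right_mono power_decreasing) auto
      finally show ?thesis by simp
    qed
    ultimately have "q + 7/10 * q\<^sup>2 \<le> d * (p + 7/10 * p\<^sup>2)" by (simp add: algebra_simps)
    also have "\<dots> \<le> d * (19/10 - X)"
    proof (intro mult_left_mono)
      have "X\<^sup>2 * X\<^sup>2 \<le> 1 * X\<^sup>2" using X2 by (intro mult_right_mono) auto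
      moreover have "p\<^sup>2 = 1 - 2 * X\<^sup>2 + X\<^sup>2 * X\<^sup>2" by (simp add: p_def power2_eq_square algebra_simps)
      \<comment> \<open>Since \<open>X ^ 4 \<le> X\<^sup>2\<close>, it is enough that
        \<open>X \<le> 17/10 * X\<^sup>2 + 1/5\<close>; \<open>5/17\<close> is the vertex of
        \<open>17/10 * X\<^sup>2 - X\<close>, and \<open>5/34 < 1/5\<close>.\<close>
      moreover have "0 \<le> (X - 5/17)\<^sup>2" by simp
      then have "X \<le> 17/10 * X\<^sup>2 + 5/34" by (simp add: power2_eq_square algebra_simps)
      moreover have "p = 1 - X\<^sup>2" by (simp add: p_def)
      ultimately show "p + 7/10 * p\<^sup>2 \<le> 19/10 - X" by linarith
    qed (use d in auto)
    also have "d * (19/10 - X) < 2 - 2 * X + d * X"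
    proof -
      \<comment> \<open>This is the difference of the two sides. The first term is positive at
        \<open>d = 0\<close>; \<open>d / 10\<close>, the gain from \<open>19/10 < 2\<close>, keeps
        the sum positive at \<open>d = 1\<close>.\<close>
      have "0 < 2 * ((1 - d) * (1 - X)) + d / 10" using d X by (cases "d = 0") (auto intro: add_nonneg_pos)
      then show ?thesis by (simp add: algebra_simps)
    qed
    finally show ?thesis .
  qed
  have cos: "1 - v\<^sup>2 / 2 \<le> cos v"
  proof -
    have "(sin (v / 2))\<^sup>2 \<le> (v / 2)\<^sup>2"
      using abs_sin_x_le_abs_x[of "v / 2"] by (metis abs_le_square_iff)
    then show ?thesis
      using cos_double_sin[of "v / 2"] by (simp add: power2_eq_square)
  qed
  \<comment> \<open>Taylor expansion gives \<open>v\<^sup>2 - v ^ 4 / 6 + v ^ 6 / 120\<close>, and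
    \<open>v\<^sup>2 \<le> 1\<close> turns the correction into at most
    \<open>- 19/120 * v ^ 4\<close>; \<open>3/20 = 18/120\<close> is slightly weaker.\<close>
  have sin: "v * sin v \<le> v\<^sup>2 * (1 - 3/20 * v\<^sup>2)"
  proof -
    have sum: "(\<Sum>m<5. sin_coeff m * v ^ m) = v - v ^ 3 / 6"
      by (simp add: sin_coeff_def lessThan_nat_numeral fact_numeral)
    have "\<bar>sin v - (v - v ^ 3 / 6)\<bar> \<le> \<bar>v\<bar> ^ 5 / 120"
      using Maclaurin_sin_bound[of v 5] unfolding sum by (simp add: fact_numeral)
    then have "\<bar>v * (sin v - (v - v ^ 3 / 6))\<bar> \<le> \<bar>v\<bar> * (\<bar>v\<bar> ^ 5 / 120)"
      unfolding abs_mult by (intro mult_left_mono) auto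
    also have "\<dots> = (v\<^sup>2) * (v\<^sup>2 * v\<^sup>2) / 120"
      by (simp add: eval_nat_numeral flip: abs_mult)
    also have "\<dots> \<le> 1 * (v\<^sup>2 * v\<^sup>2) / 120"
      using v1 by (intro divide_right_mono mult_right_mono) auto
    finally have "\<bar>v * (sin v - (v - v ^ 3 / 6))\<bar> \<le> (v\<^sup>2 * v\<^sup>2) / 120" by simp
    then have "v * (sin v - (v - v ^ 3 / 6)) \<le> (v\<^sup>2 * v\<^sup>2) / 120" by linarith
    moreover have "v * (sin v - (v - v ^ 3 / 6)) = v * sin v - v\<^sup>2 + v\<^sup>2 * v\<^sup>2 / 6"
      by (simp add: algebra_simps eval_nat_numeral)
    moreover have "v\<^sup>2 * (1 - 3/20 * v\<^sup>2) = v\<^sup>2 - 3/20 * (v\<^sup>2 * v\<^sup>2)"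
      by (simp add: algebra_simps)
    moreover have "0 \<le> v\<^sup>2 * v\<^sup>2" by simp
    ultimately show ?thesis by linarith
  qed
  have "v * sin v \<le> v\<^sup>2 * (1 - 3/20 * v\<^sup>2)" by (fact sin)
  also have "\<dots> \<le> v\<^sup>2 * ((1 + 7/10 * v\<^sup>2) * (1 - v\<^sup>2 / 2))"
  proof (intro mult_left_mono)
    \<comment> \<open>The two sides differ by \<open>7/20 * v\<^sup>2 * (1 - v\<^sup>2)\<close>:
      \<open>7/10\<close> is the least coefficient that works up to
      \<open>v\<^sup>2 = 1\<close>.\<close>
    have "0 \<le> v\<^sup>2 * (1 - v\<^sup>2)" using v1 by simp
    then show "1 - 3/20 * v\<^sup>2 \<le> (1 + 7/10 * v\<^sup>2) * (1 - v\<^sup>2 / 2)" by (simp add: algebra_simps)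
  qed auto
  also have "\<dots> = (v\<^sup>2 + 7/10 * (v\<^sup>2)\<^sup>2) * (1 - v\<^sup>2 / 2)"
    by (simp add: power2_eq_square algebra_simps)
  also have "\<dots> \<le> (q + 7/10 * q\<^sup>2) * (1 - v\<^sup>2 / 2)"
    using vq v1 by (intro mult_right_mono add_mono mult_left_mono power_mono) auto
  also have "\<dots> < (2 - 2 * X + d * X) * (1 - v\<^sup>2 / 2)"
    using lin v1 by (intro mult_strict_right_mono) auto
  also have "\<dots> \<le> (2 + x * (t + s)) * cos v"
  proof (intro mult_mono cos)
    have "- x * (t + s) \<le> X * (2 - d)" using d X by (intro mult_mono) (auto simp: X_def)
    then show "2 - 2 * X + d * X \<le> 2 + x * (t + s)" by (simp add: algebra_simps)
    then show "0 \<le> 2 + x * (t + s)" using lin X d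
      by (smt (verit) mult_nonneg_nonneg)
  qed (use v1 in auto)
  finally have main: "0 < (2 + x * (t + s)) * cos v - v * sin v" by simp
  have "Re ((1 + z * t) * exp (z * t) * cnj (exp (z * s)) + (1 + z * s) * exp (z * s) * cnj (exp (z * t)))
    = exp (x * (t + s)) * ((2 + x * (t + s)) * cos v - v * sin v)"
    unfolding v_def x_def y_def
    by (simp add: Re_exp Im_exp exp_add distrib_left right_diff_distrib cos_diff sin_diff)
       (simp add: algebra_simps)
  with main show ?thesis by simp
qed

section \<open>Moment sequences of probability measures on the unit interval\<close>

text \<open>These are the normalised Hausdorff moment sequences. The measure lives on the whole real
  line and is concentrated on \<open>{0..1}\<close> only almost everywhere, which suits densities
  over \<open>lborel\<close> and image measures.\<close>

definition unit_moments :: "(nat \<Rightarrow> real) \<Rightarrow> bool" where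
  "unit_moments c \<longleftrightarrow> (\<exists>M. prob_space M \<and> sets M = sets borel \<and>
     (AE t in M. t \<in> {0..1}) \<and> (\<forall>k. c k = (\<integral>t. t ^ k \<partial>M)))"

lemma unit_moments_one: "unit_moments (\<lambda>_. 1)"
proof -
  interpret prob_space "return borel (1::real)" by (intro prob_space_return) auto
  show ?thesis
    unfolding unit_moments_def
    by (rule exI[of _ "return borel 1"]) (auto simp: AE_return integral_return prob_space_axioms)
qed

text \<open>For independent \<open>S\<close> and \<open>T\<close> the product \<open>S * T\<close>
  again takes values in \<open>{0..1}\<close>, and its moments are the products of the
  moments.\<close>

lemma unit_moments_mult:
  assumes "unit_moments c" "unit_moments d"
  shows "unit_moments (\<lambda>k. c k * d k)"
proof -
  obtain M where M: "prob_space M" and sM [measurable_cong]: "sets M = sets borel"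
    and AEM: "AE t in M. t \<in> {0..1}" and c: "\<And>k. c k = (\<integral>t. t ^ k \<partial>M)"
    using assms(1) by (auto simp: unit_moments_def)
  obtain N where N: "prob_space N" and sN [measurable_cong]: "sets N = sets borel"
    and AEN: "AE t in N. t \<in> {0..1}" and d: "\<And>k. d k = (\<integral>t. t ^ k \<partial>N)"
    using assms(2) by (auto simp: unit_moments_def)
  interpret M: prob_space M by fact
  interpret N: prob_space N by fact
  interpret pair_prob_space M N ..
  define P where "P = distr (M \<Otimes>\<^sub>M N) borel (\<lambda>(s, t). s * t :: real)"
  have [measurable]: "(\<lambda>(s, t). s * t :: real) \<in> borel_measurable (M \<Otimes>\<^sub>M N)" by measurable
  have "prob_space P" unfolding P_def by (rule P.prob_space_distr) measurable
  moreover have "sets P = sets borel" by (simp add: P_def)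
  moreover have AEP: "AE p in M \<Otimes>\<^sub>M N. fst p \<in> {0..1} \<and> snd p \<in> {0..1}"
  proof (rule AE_pair_measure)
    show "AE x in M. AE y in N. fst (x, y) \<in> {0..1} \<and> snd (x, y) \<in> {0..1}"
      using AEM by eventually_elim (use AEN in \<open>auto elim: eventually_mono\<close>)
  qed measurable
  moreover have "AE t in P. t \<in> {0..1}"
    unfolding P_def
  proof (subst AE_distr_iff)
    show "AE p in M \<Otimes>\<^sub>M N. (case p of (s, t) \<Rightarrow> s * t) \<in> {0..1}"
      using AEP by eventually_elim (auto simp: case_prod_unfold intro: mult_le_one)
  qed auto
  moreover have "c k * d k = (\<integral>t. t ^ k \<partial>P)" for k
  proof -
    have "integrable (M \<Otimes>\<^sub>M N) (\<lambda>(s, t). s ^ k * t ^ k)"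
    proof (rule P.integrable_const_bound[of _ 1])
      show "AE p in M \<Otimes>\<^sub>M N. norm (case p of (s, t) \<Rightarrow> s ^ k * t ^ k) \<le> 1"
        using AEP by eventually_elim (auto simp: abs_mult power_le_one intro!: mult_le_one)
    qed measurable
    then have "(\<integral>p. (case p of (s, t) \<Rightarrow> s ^ k * t ^ k) \<partial>(M \<Otimes>\<^sub>M N)) = (\<integral>s. (\<integral>t. s ^ k * t ^ k \<partial>N) \<partial>M)"
      by (subst integral_fst'[symmetric]) auto
    also have "\<dots> = c k * d k" by (simp add: c d)
    finally show ?thesis
      unfolding P_def by (subst integral_distr) (auto simp: case_prod_unfold power_mult_distrib)
  qed
  ultimately show ?thesis unfolding unit_moments_def by blast
qed

lemma unit_moments_prod:
  assumes "\<And>i. i \<in> I \<Longrightarrow> unit_moments (c i)"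
  shows "unit_moments (\<lambda>k. \<Prod>i\<in>I. c i k)"
proof (cases "finite I")
  case True
  then show ?thesis using assms
    by (induction I) (auto intro: unit_moments_one unit_moments_mult)
qed (simp add: unit_moments_one)

text \<open>The measure is the Beta distribution with parameters \<open>a\<close> and
  \<open>b - a\<close>, both positive by \<open>a < b\<close>. Multiplying its density by
  \<open>t ^ k\<close> shifts \<open>a\<close> to \<open>a + k\<close>, and the quotient of the two
  Beta values is the Pochhammer quotient.\<close>

lemma unit_moments_pochhammer:
  fixes a b :: real
  assumes a: "0 < a" and ab: "a < b"
  shows "unit_moments (\<lambda>k. pochhammer a k / pochhammer b k)"
proof -
  define g :: "real \<Rightarrow> real" where
    "g = (\<lambda>t. indicator {0..1} t * (t powr (a - 1) * (1 - t) powr (b - a - 1)) / Beta a (b - a))"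
  have B: "Beta a (b - a) > 0" using a ab by (simp add: Beta_def Gamma_real_pos)
  have [measurable]: "g \<in> borel_measurable borel" unfolding g_def by measurable
  have g0: "g t \<ge> 0" for t using B by (auto simp: g_def indicator_def)
  have mom: "((\<lambda>t. g t * t ^ k) has_integral pochhammer a k / pochhammer b k) UNIV" for k
  proof -
    have "((\<lambda>t. t powr (a + k - 1) * (1 - t) powr (b - a - 1)) has_integral Beta (a + k) (b - a)) {0..1}"
      using has_integral_Beta_real[of "a + k" "b - a"] a ab by simp
    then have "((\<lambda>t. t powr (a + k - 1) * (1 - t) powr (b - a - 1) / Beta a (b - a)) has_integral Beta (a + k) (b - a) / Beta a (b - a)) {0..1}"
      by (rule has_integral_divide)
    moreover have "t powr (a + k - 1) * (1 - t) powr (b - a - 1) / Beta a (b - a) = g t * t ^ k" if "t \<in> {0..1}" for t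
    \<comment> \<open>Merging \<open>t ^ k\<close> into the power needs \<open>t > 0\<close>; at
      \<open>t = 0\<close> both sides vanish because \<open>0 powr x = 0\<close> for every
      \<open>x\<close>.\<close>
    proof (cases "t = 0")
      case False
      then have "t powr (a + k - 1) = t powr (a - 1) * t ^ k"
        using that by (simp add: powr_realpow[symmetric] powr_add[symmetric] algebra_simps)
      then show ?thesis using that by (simp add: g_def)
    qed (simp add: g_def)
    ultimately have "((\<lambda>t. g t * t ^ k) has_integral Beta (a + k) (b - a) / Beta a (b - a)) {0..1}"
      by (rule has_integral_eq[rotated]) 
    moreover have "Beta (a + k) (b - a) / Beta a (b - a) = pochhammer a k / pochhammer b k"
    proof -
      have "a \<notin> \<int>\<^sub>\<le>\<^sub>0" "b \<notin> \<int>\<^sub>\<le>\<^sub>0" using a ab by (auto elim!: nonpos_Ints_cases)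
      moreover have "Gamma a > 0" "Gamma b > 0" "Gamma (b - a) > 0" "Gamma (b + k) > 0"
        using a ab by (auto intro!: Gamma_real_pos)
      ultimately show ?thesis
        by (simp add: Beta_def pochhammer_Gamma field_simps)
    qed
    moreover have "(if t \<in> {0..1} then g t * t ^ k else 0) = g t * t ^ k" for t
      by (simp add: g_def)
    ultimately show ?thesis
      using has_integral_restrict_UNIV[of "{0..1}" "\<lambda>t. g t * t ^ k"] by simp
  qed
  define M where "M = density lborel g"
  have "emeasure M (space M) = 1"
  proof -
    have "integral\<^sup>N lborel g = ennreal 1"
      using mom[of 0] g0 by (intro nn_integral_has_integral_lborel) auto
    then show ?thesis by (simp add: M_def emeasure_density)
  qed
  then have "prob_space M" by (rule prob_spaceI)
  moreover have "sets M = sets borel" by (simp add: M_def)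
  moreover have "AE t in M. t \<in> {0..1}"
    unfolding M_def by (subst AE_density) (auto simp: g_def indicator_def)
  moreover have "pochhammer a k / pochhammer b k = (\<integral>t. t ^ k \<partial>M)" for k
  proof -
    \<comment> \<open>For \<open>t < 0\<close> the power may be negative, but \<open>g\<close>
      vanishes there.\<close>
    have gk0: "0 \<le> g t * t ^ k" for t
      using mult_nonneg_nonneg[OF g0[of t], of "t ^ k"] by (cases "t \<in> {0..1}") (auto simp: g_def)
    have "integral\<^sup>N lborel (\<lambda>t. g t * t ^ k) = ennreal (pochhammer a k / pochhammer b k)"
      using mom gk0 by (intro nn_integral_has_integral_lborel) auto
    then have "(\<integral>t. g t * t ^ k \<partial>lborel) = pochhammer a k / pochhammer b k"
      using gk0 a ab by (intro integral_eq_nn_integral[THEN trans])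
        (auto simp: pochhammer_nonneg)
    then show ?thesis using g0 by (simp add: M_def integral_density)
  qed
  ultimately show ?thesis unfolding unit_moments_def by blast
qed

section \<open>The exponential transform of a moment sequence\<close>

text \<open>The exponential series is integrated term by term, dominated by the series of
  \<open>exp (norm z)\<close>. The case \<open>j = 0\<close> gives the transform,
  \<open>j = 1\<close> its derivative.\<close>

lemma exp_moments_sums:
  fixes z :: complex
  assumes "prob_space M" and sM [measurable_cong]: "sets M = sets borel" and AEM: "AE t in M. t \<in> {0..1::real}"
  shows "(\<lambda>k. of_real (\<integral>t. t ^ (k + j) \<partial>M) * z ^ k / fact k) sums (\<integral>t. of_real (t ^ j) * exp (z * of_real t) \<partial>M)"
proof -
  interpret prob_space M by fact
  define f :: "nat \<Rightarrow> real \<Rightarrow> complex" where "f = (\<lambda>k t. of_real (t ^ (k + j)) * z ^ k / fact k)"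
  have int_pow: "integrable M (\<lambda>t. t ^ k)" for k
  proof (rule integrable_const_bound[of _ 1])
    show "AE t in M. norm (t ^ k) \<le> 1"
      using AEM by eventually_elim (simp add: power_abs power_le_one)
  qed measurable
  have int: "integrable M (f k)" for k
    unfolding f_def by (intro integrable_divide integrable_mult_left integrable_of_real int_pow)
  have f_sums: "(\<lambda>k. f k t) sums (of_real (t ^ j) * exp (z * of_real t))" for t
    using sums_mult[OF exp_converges[of "z * of_real t"], of "of_real (t ^ j)"]
    by (simp add: f_def scaleR_conv_of_real power_mult_distrib power_add field_simps)
  have summ: "summable (\<lambda>k. norm (f k t))" for t
  proof -
    have "summable (\<lambda>k. norm (of_real (t ^ j) :: complex) * norm ((z * of_real t) ^ k /\<^sub>R fact k))"
      by (intro summable_mult summable_norm_exp)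
    then show ?thesis
      by (simp add: f_def norm_mult norm_divide norm_power power_mult_distrib power_add field_simps)
  qed
  have "summable (\<lambda>k. \<integral>t. norm (f k t) \<partial>M)"
  proof (rule summable_comparison_test)
    have "(\<integral>t. norm (f k t) \<partial>M) \<le> norm (z ^ k /\<^sub>R fact k)" for k
    proof (rule integral_le_const)
      show "integrable M (\<lambda>t. norm (f k t))" using int by (rule integrable_norm)
      show "AE t in M. norm (f k t) \<le> norm (z ^ k /\<^sub>R fact k)"
        using AEM
      proof eventually_elim
        case (elim t)
        then have "\<bar>t\<bar> ^ (k + j) * norm (z ^ k /\<^sub>R fact k) \<le> 1 * norm (z ^ k /\<^sub>R fact k)"
          by (intro mult_right_mono power_le_one) auto
        then show ?case by (simp add: f_def norm_mult norm_divide norm_power field_simps)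
      qed
    qed
    then show "\<exists>N. \<forall>k\<ge>N. norm (\<integral>t. norm (f k t) \<partial>M) \<le> norm (z ^ k /\<^sub>R fact k)" by simp
    show "summable (\<lambda>k. norm (z ^ k /\<^sub>R fact k))" by (rule summable_norm_exp)
  qed
  then have "(\<lambda>k. integral\<^sup>L M (f k)) sums (\<integral>t. (\<Sum>k. f k t) \<partial>M)"
    using int summ by (intro sums_integral) auto
  moreover have "(\<integral>t. (\<Sum>k. f k t) \<partial>M) = (\<integral>t. of_real (t ^ j) * exp (z * of_real t) \<partial>M)"
    using f_sums by (simp add: sums_iff)
  moreover have "integral\<^sup>L M (f k) = of_real (\<integral>t. t ^ (k + j) \<partial>M) * z ^ k / fact k" for k
    by (simp add: f_def del: of_real_power)
  ultimately show ?thesis by simp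
qed

text \<open>\<open>B\<close> is the derivative of \<open>A\<close> in \<open>z\<close>, so
  \<open>A + z * B\<close> is the derivative of \<open>z * A\<close>. The positive kernel is
  integrated in \<open>t\<close> and then in \<open>s\<close>; by linearity each of its two summands
  contributes \<open>(A + z * B) * cnj A\<close>.\<close>

lemma Re_exp_transform_pos:
  fixes z :: complex
  assumes "prob_space M" and sM [measurable_cong]: "sets M = sets borel" and AEM: "AE t in M. t \<in> {0..1::real}"
    and z: "norm z < 1"
  defines "A \<equiv> (\<integral>t. exp (z * of_real t) \<partial>M)" and "B \<equiv> (\<integral>t. of_real t * exp (z * of_real t) \<partial>M)"
  shows "0 < Re ((A + z * B) * cnj A)"
proof -
  interpret prob_space M by fact
  \<comment> \<open>Strict positivity almost everywhere survives integration because the total mass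
    is \<open>1\<close>.\<close>
  have pos: "0 < Re (integral\<^sup>L M f)" if f: "integrable M f" "AE t in M. 0 < Re (f t)" for f
  proof -
    have "(\<integral>t. 0 \<partial>M) < (\<integral>t. Re (f t) \<partial>M)"
      using f by (intro integral_less_AE_space) (auto simp: emeasure_space_1)
    then show ?thesis using f by simp
  qed
  define e d where "e = (\<lambda>t::real. exp (z * of_real t))" and "d = (\<lambda>t::real. (1 + z * of_real t) * e t)"
  have norm_e: "norm (e t) \<le> exp 1" if "t \<in> {0..1}" for t
  proof -
    have "Re (z * of_real t) \<le> norm z * \<bar>t\<bar>"
      by (metis complex_Re_le_cmod norm_mult norm_of_real)
    also have "\<dots> \<le> 1 * 1" using z that by (intro mult_mono) auto
    finally show ?thesis by (simp add: e_def)
  qed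
  have [measurable]: "e \<in> borel_measurable borel" unfolding e_def by measurable
  have int_e: "integrable M e"
  proof (rule integrable_const_bound[of _ "exp 1"])
    show "AE t in M. norm (e t) \<le> exp 1"
      using AEM by eventually_elim (rule norm_e)
  qed measurable
  have int_te: "integrable M (\<lambda>t. of_real t * e t)"
  proof (rule integrable_const_bound[of _ "exp 1"])
    show "AE t in M. norm (of_real t * e t) \<le> exp 1"
      using AEM
    proof eventually_elim
      case (elim t)
      then have "norm (of_real t * e t) \<le> 1 * exp 1"
        unfolding norm_mult using norm_e[of t] by (intro mult_mono) auto
      then show ?case by simp
    qed
  qed measurable
  have d_eq: "d = (\<lambda>t. e t + z * (of_real t * e t))" by (simp add: d_def fun_eq_iff algebra_simps)
  have int_d: "integrable M d" unfolding d_eq using int_e int_te by simp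
  have Id: "integral\<^sup>L M d = A + z * B"
    unfolding d_eq using int_e int_te by (simp add: A_def B_def e_def)
  have Ie: "integral\<^sup>L M e = A" by (simp add: A_def e_def)
  have inner: "(\<integral>t. d t * cnj (e s) + d s * cnj (e t) \<partial>M) = (A + z * B) * cnj (e s) + d s * cnj A" for s
    using int_e int_d by (simp add: Id Ie)
  have "AE s in M. 0 < Re (\<integral>t. d t * cnj (e s) + d s * cnj (e t) \<partial>M)"
    using AEM
  proof eventually_elim
    case (elim s)
    have "AE t in M. 0 < Re (d t * cnj (e s) + d s * cnj (e t))"
      using AEM
    proof eventually_elim
      case (elim t)
      then show ?case
        using one_plus_id_exp_kernel_pos[OF z, of t s] \<open>s \<in> {0..1}\<close> unfolding d_def e_def by simp
    qed
    then show ?case using int_e int_d by (intro pos) auto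
  qed
  then have "0 < Re (\<integral>s. (A + z * B) * cnj (e s) + d s * cnj A \<partial>M)"
    unfolding inner using int_e int_d by (intro pos) auto
  also have "(\<integral>s. (A + z * B) * cnj (e s) + d s * cnj A \<partial>M) = 2 * ((A + z * B) * cnj A)"
    using int_e int_d by (simp add: Id Ie)
  finally show ?thesis by simp
qed

text \<open>Termwise differentiation shifts the moments by one, which identifies the derivative of
  \<open>A\<close> as \<open>B\<close>. Positivity of
  \<open>Re ((A z + z * B z) * cnj (A z))\<close> also excludes zeros of \<open>A\<close>, so
  dividing by the squared norm of \<open>A z\<close> yields the starlikeness condition.\<close>

lemma starlike_function_exp_transform:
  assumes c: "unit_moments c"
  shows "starlike_function (\<lambda>z. z * (\<Sum>k. of_real (c k) * z ^ k / fact k))"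
proof -
  obtain M where M: "prob_space M" "sets M = sets borel" "AE t in M. t \<in> {0..1}"
    and cM: "\<And>k. c k = (\<integral>t. t ^ k \<partial>M)"
    using c by (auto simp: unit_moments_def)
  interpret prob_space M by fact
  define F where "F = (\<lambda>z::complex. \<Sum>k. of_real (c k) * z ^ k / fact k)"
  define A where "A = (\<lambda>z::complex. \<integral>t. exp (z * of_real t) \<partial>M)"
  define B where "B = (\<lambda>z::complex. \<integral>t. of_real t * exp (z * of_real t) \<partial>M)"
  have A_sums: "(\<lambda>k. of_real (c k) * z ^ k / fact k) sums A z" for z
    using exp_moments_sums[OF M, of 0 z] by (simp add: A_def cM)
  have B_sums: "(\<lambda>k. of_real (c (Suc k)) * z ^ k / fact k) sums B z" for z
    using exp_moments_sums[OF M, of 1 z] by (simp add: B_def cM)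
  have F_A: "F = A"
    using A_sums by (auto simp: F_def sums_iff)
  have A0: "A 0 = 1" by (simp add: A_def prob_space)
  have dA: "(A has_field_derivative B z) (at z)" for z
  proof -
    let ?c = "\<lambda>k. of_real (c k) / fact k :: complex"
    have "summable (\<lambda>k. ?c k * w ^ k)" for w
      using A_sums[of w] by (simp add: sums_iff)
    then have "((\<lambda>w. \<Sum>k. ?c k * w ^ k) has_field_derivative (\<Sum>k. diffs ?c k * z ^ k)) (at z)"
      by (rule termdiffs_strong_converges_everywhere)
    moreover have "(\<lambda>w. \<Sum>k. ?c k * w ^ k) = A"
      using A_sums by (auto simp: sums_iff)
    moreover have "diffs ?c k * z ^ k = of_real (c (Suc k)) * z ^ k / fact k" for k
      by (simp add: diffs_def fact_Suc field_simps del: of_nat_Suc)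
    ultimately show ?thesis using B_sums[of z] by (simp add: sums_iff)
  qed
  have df: "((\<lambda>z. z * A z) has_field_derivative A z + z * B z) (at z)" for z
    using DERIV_mult[OF DERIV_ident dA[of z]] by (simp add: algebra_simps)
  have "starlike_function (\<lambda>z. z * A z)"
  proof (rule starlike_functionI)
    show "(\<lambda>z. z * A z) holomorphic_on ball 0 1"
      using df by (auto simp: holomorphic_on_def field_differentiable_def intro: has_field_derivative_at_within)
    show "deriv (\<lambda>z. z * A z) 0 = 1"
      using DERIV_imp_deriv[OF df[of 0]] A0 by simp
  next
    fix z :: complex assume z: "norm z < 1" "z \<noteq> 0"
    have pos: "0 < Re ((A z + z * B z) * cnj (A z))"
      unfolding A_def B_def by (rule Re_exp_transform_pos[OF M z(1)])
    then have "A z \<noteq> 0" by auto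
    have "z * deriv (\<lambda>z. z * A z) z / (z * A z) = (A z + z * B z) / A z"
      using z DERIV_imp_deriv[OF df[of z]] by simp
    also have "\<dots> = (A z + z * B z) * cnj (A z) / of_real ((norm (A z))\<^sup>2)"
      using \<open>A z \<noteq> 0\<close> unfolding complex_norm_square by simp
    finally have "Re (z * deriv (\<lambda>z. z * A z) z / (z * A z)) = Re ((A z + z * B z) * cnj (A z)) / (norm (A z))\<^sup>2"
      by (simp only: Re_divide_of_real)
    also have "\<dots> > 0" using pos \<open>A z \<noteq> 0\<close> by (intro divide_pos_pos) auto
    finally show "0 < Re (z * deriv (\<lambda>z. z * A z) z / (z * A z))" .
  qed simp
  then show ?thesis by (simp add: F_A[symmetric] F_def)
qed

section \<open>From the parameter bound to the hypergeometric function\<close>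

text \<open>For \<open>b = a\<close> the bound would read
  \<open>sqrt ?D < 4 * a + 2 - sqrt 5 * a\<close>, whereas \<open>exp 1 \<ge> 2\<close> and
  \<open>sqrt 5 \<ge> 2\<close> make the square of the right side at most \<open>?D\<close>.\<close>

lemma parameter_bound_imp_less:
  fixes a b :: real
  assumes a: "0 < a" and ab: "a \<le> b"
    and bound: "b > (- 2 + sqrt 5 * a + sqrt ((sqrt 5 * a - 2)\<^sup>2 + 8 * a * sqrt 5 * (exp 1 * (a + 1) - a))) / 4"
  shows "a < b"
proof (rule ccontr)
  assume "\<not> a < b"
  then have "b = a" using ab by simp
  let ?D = "(sqrt 5 * a - 2)\<^sup>2 + 8 * a * sqrt 5 * (exp 1 * (a + 1) - a)"
  have e: "2 \<le> exp (1::real)" using exp_ge_add_one_self[of 1] by simp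
  have s: "2 \<le> sqrt 5" by (rule real_le_rsqrt) simp
  have "(4 * a + 2 - sqrt 5 * a)\<^sup>2 \<le> ?D"
  proof -
    have "2 * (a + 1) \<le> exp 1 * (a + 1)" using e a by (intro mult_right_mono) auto
    then have "a + 2 \<le> exp 1 * (a + 1) - a" by simp
    then have "8 * a * sqrt 5 * (a + 2) \<le> 8 * a * sqrt 5 * (exp 1 * (a + 1) - a)"
      using a by (intro mult_left_mono) auto
    moreover have "(4 * a + 2 - sqrt 5 * a)\<^sup>2 = (sqrt 5 * a - 2)\<^sup>2 + 16 * a\<^sup>2 + 16 * a - 8 * (sqrt 5 * a\<^sup>2)"
      by (simp add: power2_eq_square algebra_simps)
    moreover have "2 * a\<^sup>2 \<le> sqrt 5 * a\<^sup>2" "2 * a \<le> sqrt 5 * a"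
      using s a by (auto intro!: mult_right_mono)
    moreover have "8 * a * sqrt 5 * (a + 2) = 8 * (sqrt 5 * a\<^sup>2) + 16 * (sqrt 5 * a)"
      by (simp add: power2_eq_square algebra_simps)
    ultimately show ?thesis using a zero_le_power2[of a] by linarith
  qed
  then have "4 * a + 2 - sqrt 5 * a \<le> sqrt ?D" by (rule real_le_rsqrt)
  moreover have "(- 2 + sqrt 5 * a + sqrt ?D) / 4 < a"
    using bound unfolding \<open>b = a\<close> .
  \<comment> \<open>With \<open>r\<close> for \<open>sqrt 5 * a\<close> and \<open>S\<close> for
    \<open>sqrt ?D\<close> the contradiction is linear.\<close>
  moreover have False if "4 * a + 2 - r \<le> S" "(- 2 + r + S) / 4 < a" for r S :: real
    using that by (simp add: field_simps)
  ultimately show False by blast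
qed

theorem corollary5:
  fixes p :: nat and a b :: "real list"
  assumes "p \<ge> 1" and "length a = p" and "length b = p"
    and "\<And>i. i < p \<Longrightarrow> a ! i > 0"
    and "\<And>i. i < p \<Longrightarrow> b ! i \<ge> a ! i"
    and "\<And>i. i < p \<Longrightarrow>
           b ! i > (- 2 + sqrt 5 * a ! i
                    + sqrt ((sqrt 5 * a ! i - 2)\<^sup>2
                            + 8 * a ! i * sqrt 5 * (exp 1 * (a ! i + 1) - a ! i))) / 4"
  shows "starlike_function
           (normalized_hypergeometric (map complex_of_real a) (map complex_of_real b))"
proof -
  define c where "c = (\<lambda>k. \<Prod>i<p. pochhammer (a ! i) k / pochhammer (b ! i) k)"
  have "unit_moments c"
    unfolding c_def
  proof (rule unit_moments_prod)
    fix i assume "i \<in> {..<p}"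
    then have i: "i < p" by simp
    show "unit_moments (\<lambda>k. pochhammer (a ! i) k / pochhammer (b ! i) k)"
      using assms(4)[OF i] parameter_bound_imp_less[OF assms(4)[OF i] assms(5)[OF i] assms(6)[OF i]]
      by (rule unit_moments_pochhammer)
  qed
  then have "starlike_function (\<lambda>z. z * (\<Sum>k. of_real (c k) * z ^ k / fact k))"
    by (rule starlike_function_exp_transform)
  \<comment> \<open>The quotient of the two products of Pochhammer symbols is the product of
    quotients \<open>c k\<close>, and the real parameters pass through
    \<open>of_real\<close>.\<close>
  moreover have "normalized_hypergeometric (map complex_of_real a) (map complex_of_real b)
      = (\<lambda>z. z * (\<Sum>k. of_real (c k) * z ^ k / fact k))"
    using assms(2,3)
    by (simp add: fun_eq_iff normalized_hypergeometric_def hypergeometric_eq_suminf c_def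
        pochhammer_of_real prod_dividef)
  ultimately show ?thesis by simp
qed

end
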